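(* Let $g,s$ be positive integers with $gs\ge 2$, and let $S=\{1,\,g+1,\,2g+1,\dots,(s-1)g+1\}$ be the set of the first $s$ positive integers $j$ with $j\equiv1\pmod g$. Then the number of parking functions of length $gs-1$ all of whose preferences lie in $S$ is $$\#\mathrm{PF}_{gs-1\mid S}=s^{gs-2}.$$
   Context: $[m]=\{1,\dots,m\}$. For a positive integer $m$, a parking function of length $m$ (on $m$ cars) is a function $\pi:[m]\to[m]$ such that $\#\pi^{-1}([i])\ge i$ for every $i\in[m]$. For a set $S$ of positive integers, $\mathrm{PF}_{m\mid S}$ denotes the set of parking functions of length $m$ whose image is contained in $S$ (equivalently, in $S\cap[m]$). *)

theory Defs
  imports Main "HOL-Library.FuncSet"
begin

text \<open>
  Functions from \<open>[m]\<close> to \<open>[m]\<close> are taken from the extensional function space \<open>\<rightarrow>\<^sub>E\<close>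
  (value \<open>undefined\<close> outside \<open>{1..m}\<close>), so that distinct elements of the sets below
  are distinct functions on \<open>[m]\<close> and cardinalities are the intended ones.
\<close>

definition parking_functions :: "nat \<Rightarrow> (nat \<Rightarrow> nat) set" where
  "parking_functions m =
     {\<pi> \<in> {1..m} \<rightarrow>\<^sub>E {1..m}. \<forall>i\<in>{1..m}. card (\<pi> -` {1..i} \<inter> {1..m}) \<ge> i}"

definition restricted_parking_functions :: "nat \<Rightarrow> nat set \<Rightarrow> (nat \<Rightarrow> nat) set" where
  "restricted_parking_functions m S = {\<pi> \<in> parking_functions m. \<pi> ` {1..m} \<subseteq> S}"

end

theory Submission
  imports Defs
begin

text \<open>
  Pollak's circle argument. Reading preferences in \<open>S\<close> as residues modulo \<open>s\<close>, the cyclic group of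
  order \<open>s\<close> acts on the \<open>s ^ (g * s - 1)\<close> preference functions by simultaneous translation. The
  walk \<open>H k = #{x. f x < k} - k * g\<close> satisfies \<open>H s = H 0 - 1\<close>, so by the cycle lemma exactly one
  translate of \<open>f\<close> is a parking function, namely the one that starts at the first minimum of \<open>H\<close>.
\<close>

text \<open>A value \<open>v\<close> stands for the preference \<open>v * g + 1\<close>. The number
  of preferences at most \<open>i\<close> is constant for \<open>i\<close> from
  \<open>(k - 1) * g + 1\<close> to \<open>k * g\<close>, so only the parking condition at the last
  point \<open>i = k * g\<close> of each block is kept.\<close>

definition ballot_functions :: "nat \<Rightarrow> nat \<Rightarrow> 'a set \<Rightarrow> ('a \<Rightarrow> nat) set" where
  "ballot_functions g s A = {f \<in> A \<rightarrow>\<^sub>E {..<s}. \<forall>k<s. k * g \<le> card {x \<in> A. f x < k}}"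

text \<open>Subtraction of \<open>j\<close> modulo \<open>s\<close>, written as addition of
  \<open>s - j\<close> because subtraction on naturals truncates; the value \<open>j\<close> becomes
  \<open>0\<close>.\<close>

definition rotate_values :: "nat \<Rightarrow> 'a set \<Rightarrow> nat \<Rightarrow> ('a \<Rightarrow> nat) \<Rightarrow> 'a \<Rightarrow> nat" where
  "rotate_values s A j f = (\<lambda>x\<in>A. (f x + (s - j)) mod s)"

definition walk :: "nat \<Rightarrow> 'a set \<Rightarrow> ('a \<Rightarrow> nat) \<Rightarrow> nat \<Rightarrow> int" where
  "walk g A f k = int (card {x \<in> A. f x < k}) - int (k * g)"

section \<open>Cyclic translation of values and the walk\<close>

lemma rotate_value_eq:
  fixes v j s :: nat
  assumes "v < s" "j < s"
  shows "(v + (s - j)) mod s = (if j \<le> v then v - j else v + s - j)"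
  using assms by (auto simp: mod_if)

lemma bij_betw_rotate_values:
  assumes "finite A" "j < s"
  shows "bij_betw (rotate_values s A j) (A \<rightarrow>\<^sub>E {..<s}) (A \<rightarrow>\<^sub>E {..<s})"
proof -
  let ?F = "A \<rightarrow>\<^sub>E {..<s}"
  have "inj_on (rotate_values s A j) ?F"
  proof (rule inj_onI)
    fix f f'
    assume f: "f \<in> ?F" and f': "f' \<in> ?F" and eq: "rotate_values s A j f = rotate_values s A j f'"
    show "f = f'"
    proof (rule PiE_ext[OF f f'])
      fix x assume x: "x \<in> A"
      have "f x < s" "f' x < s"
        using f f' x by auto
      moreover have "(f x + (s - j)) mod s = (f' x + (s - j)) mod s"
        using fun_cong[OF eq, of x] x by (simp add: rotate_values_def)
      ultimately show "f x = f' x"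
        using \<open>j < s\<close> rotate_value_eq[of "f x" s j] rotate_value_eq[of "f' x" s j]
        by (auto split: if_splits)
    qed
  qed
  moreover have "rotate_values s A j ` ?F \<subseteq> ?F"
    using \<open>j < s\<close> by (auto simp: rotate_values_def)
  ultimately show ?thesis
    using \<open>finite A\<close> by (simp add: bij_betw_def endo_inj_surj finite_PiE)
qed

text \<open>The values sent below \<open>k\<close> form the cyclic interval of length
  \<open>k\<close> starting at \<open>j\<close>: either \<open>[j, j + k)\<close>, or, after
  wrapping around, \<open>[j, s)\<close> together with \<open>[0, j + k - s)\<close>.\<close>

lemma card_rotate_values_less:
  assumes "finite A" "f \<in> A \<rightarrow>\<^sub>E {..<s}" "j < s" "k < s"
  shows "int (card {x \<in> A. rotate_values s A j f x < k}) =
    (if j + k \<le> s then int (card {x \<in> A. f x < j + k}) - int (card {x \<in> A. f x < j})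
     else int (card A) - int (card {x \<in> A. f x < j}) + int (card {x \<in> A. f x < j + k - s}))"
proof -
  have v: "f x < s" if "x \<in> A" for x
    using that assms(2) by auto
  have r: "rotate_values s A j f x = (if j \<le> f x then f x - j else f x + s - j)" if "x \<in> A" for x
    using that rotate_value_eq[OF v[OF that] \<open>j < s\<close>] by (simp add: rotate_values_def)
  show ?thesis
  proof (cases "j + k \<le> s")
    case True
    have "{x \<in> A. rotate_values s A j f x < k} = {x \<in> A. f x < j + k} - {x \<in> A. f x < j}"
      using r v True by (fastforce split: if_splits)
    moreover have "{x \<in> A. f x < j} \<subseteq> {x \<in> A. f x < j + k}"
      by auto
    ultimately show ?thesis
      using True \<open>finite A\<close> by (simp add: card_Diff_subset card_mono of_nat_diff)
  next
    case False
    have "{x \<in> A. rotate_values s A j f x < k} = (A - {x \<in> A. f x < j}) \<union> {x \<in> A. f x < j + k - s}"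
      using r v False \<open>j < s\<close> \<open>k < s\<close> by (fastforce split: if_splits)
    moreover have "(A - {x \<in> A. f x < j}) \<inter> {x \<in> A. f x < j + k - s} = {}"
      using \<open>k < s\<close> by auto
    moreover have "card {x \<in> A. f x < j} \<le> card A"
      using \<open>finite A\<close> by (simp add: card_mono)
    ultimately show ?thesis
      using False \<open>finite A\<close> by (simp add: card_Un_disjoint card_Diff_subset of_nat_diff)
  qed
qed

text \<open>The ballot condition at \<open>k\<close> compares the walk at \<open>j\<close> with the
  walk at \<open>j + k\<close> modulo \<open>s\<close>. Before wrapping it is a weak inequality;
  after wrapping, the drop by 1 over a full turn makes it strict. So \<open>j\<close> must be the
  first minimum.\<close>

lemma rotate_values_ballot_iff:
  assumes "finite A" "card A + 1 = g * s" "f \<in> A \<rightarrow>\<^sub>E {..<s}" "j < s"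
  shows "rotate_values s A j f \<in> ballot_functions g s A \<longleftrightarrow>
    (\<forall>i<s. walk g A f j \<le> walk g A f i \<and> (i < j \<longrightarrow> walk g A f j < walk g A f i))"
    (is "_ \<longleftrightarrow> (\<forall>i<s. ?Q i)")
proof -
  let ?r = "rotate_values s A j f"
  have "?r \<in> A \<rightarrow>\<^sub>E {..<s}"
    using bij_betw_rotate_values[OF \<open>finite A\<close> \<open>j < s\<close>] \<open>f \<in> _\<close> by (auto simp: bij_betw_def)
  then have "?r \<in> ballot_functions g s A \<longleftrightarrow>
      (\<forall>k<s. int (k * g) \<le> int (card {x \<in> A. ?r x < k}))"
    unfolding ballot_functions_def by (simp only: mem_Collect_eq of_nat_le_iff simp_thms)
  also have "\<dots> \<longleftrightarrow> (\<forall>i<s. ?Q i)"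
  proof -
    have total: "int (card A) = int g * int s - 1"
      using assms(2) by (metis add_diff_cancel_right' of_nat_1 of_nat_add of_nat_mult)
    have low: "int (k * g) \<le> int (card {x \<in> A. ?r x < k}) \<longleftrightarrow> ?Q (j + k)"
      if "k < s" "j + k < s" for k
      using that card_rotate_values_less[OF assms(1,3,4) \<open>k < s\<close>]
      by (auto simp: walk_def algebra_simps)
    have high: "int (k * g) \<le> int (card {x \<in> A. ?r x < k}) \<longleftrightarrow> ?Q (j + k - s)"
      if "k < s" "s \<le> j + k" for k
    proof -
      \<comment> \<open>This brings the boundary \<open>j + k = s\<close>, which the counting lemma
        treats as unwrapped, into the wrapped form with index \<open>0\<close>.\<close>
      have "{x \<in> A. f x < s} = A"
        using \<open>f \<in> _\<close> by auto
      then have count: "int (card {x \<in> A. ?r x < k}) = int g * int s - 1 -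
          int (card {x \<in> A. f x < j}) + int (card {x \<in> A. f x < j + k - s})"
        using that card_rotate_values_less[OF assms(1,3,4) \<open>k < s\<close>] total
        by (cases "j + k = s") auto
      obtain i where i: "j + k = s + i"
        using \<open>s \<le> j + k\<close> le_Suc_ex by blast
      then have "i < j" and index: "j + k - s = i"
        using \<open>k < s\<close> by auto
      \<comment> \<open>After \<open>g * s\<close> cancels against \<open>count\<close>, the
        remaining \<open>- 1\<close> turns the weak inequality into the strict one required for
        \<open>i < j\<close>.\<close>
      have "int (k * g) = int g * int s + int (i * g) - int (j * g)"
        using arg_cong[OF i, of "\<lambda>n. int (n * g)"] by (simp add: algebra_simps)
      then show ?thesis
        using count \<open>i < j\<close> unfolding walk_def index by auto
    qed
    show ?thesis
    proof (intro iffI allI impI)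
      fix i assume *: "\<forall>k<s. int (k * g) \<le> int (card {x \<in> A. ?r x < k})" and "i < s"
      \<comment> \<open>The condition to use is the one at the cyclic distance from \<open>j\<close>
        to \<open>i\<close>, namely \<open>i - j\<close> or \<open>i + s - j\<close>.\<close>
      show "?Q i"
      proof (cases "j \<le> i")
        case True
        then show ?thesis
          using low[of "i - j"] *[rule_format, of "i - j"] \<open>i < s\<close> by simp
      next
        case False
        then show ?thesis
          using high[of "i + s - j"] *[rule_format, of "i + s - j"] \<open>i < s\<close> \<open>j < s\<close> by simp
      qed
    next
      fix k assume *: "\<forall>i<s. ?Q i" and "k < s"
      show "int (k * g) \<le> int (card {x \<in> A. ?r x < k})"
      proof (cases "j + k < s")
        case True
        then show ?thesis
          using low[of k] * \<open>k < s\<close> by blast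
      next
        case False
        then have "j + k - s < s"
          using \<open>j < s\<close> \<open>k < s\<close> by linarith
        then show ?thesis
          using high[of k] * \<open>k < s\<close> False by (meson not_less)
      qed
    qed
  qed
  finally show ?thesis .
qed

section \<open>First minima and the count of ballot functions\<close>

lemma ex1_first_minimum:
  fixes H :: "nat \<Rightarrow> 'b :: linorder"
  assumes "0 < s"
  shows "\<exists>!j. j < s \<and> (\<forall>i<s. H j \<le> H i \<and> (i < j \<longrightarrow> H j < H i))"
proof -
  define M where "M = Min (H ` {..<s})"
  have M_le: "M \<le> H i" if "i < s" for i
    using that by (simp add: M_def)
  have "M \<in> H ` {..<s}"
    unfolding M_def using assms by (intro Min_in) auto
  then have ex: "\<exists>j. j < s \<and> H j = M"
    by auto
  define j where "j = (LEAST j. j < s \<and> H j = M)"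
  have "j < s" "H j = M"
    using LeastI_ex[OF ex] by (simp_all add: j_def)
  have "M \<noteq> H i" if "i < j" for i
    using not_less_Least[of i "\<lambda>j. j < s \<and> H j = M"] that \<open>j < s\<close> by (auto simp: j_def)
  then have first: "\<forall>i<s. H j \<le> H i \<and> (i < j \<longrightarrow> H j < H i)"
    using M_le by (auto simp: \<open>H j = M\<close> intro: le_neq_trans)
  show ?thesis
  proof (rule ex1I[of _ j])
    show "j < s \<and> (\<forall>i<s. H j \<le> H i \<and> (i < j \<longrightarrow> H j < H i))"
      using \<open>j < s\<close> first by (rule conjI)
  next
    fix j'
    assume "j' < s \<and> (\<forall>i<s. H j' \<le> H i \<and> (i < j' \<longrightarrow> H j' < H i))"
    then have "H j' \<le> H j" "j < j' \<longrightarrow> H j' < H j" "H j \<le> H j'" "j' < j \<longrightarrow> H j < H j'"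
      using \<open>j < s\<close> first by blast+
    then show "j' = j"
      by (metis linorder_neqE_nat not_le)
  qed
qed

text \<open>Double counting of the pairs \<open>(f, j)\<close> whose rotation is a ballot function:
  each \<open>f\<close> admits exactly one \<open>j\<close>, and each \<open>j\<close> contributes
  \<open>card ?B\<close> functions since rotation is a bijection. Hence
  \<open>s ^ card A = card ?B * s\<close>.\<close>

lemma card_ballot_functions:
  assumes "finite A" "A \<noteq> {}" "card A + 1 = g * s"
  shows "card (ballot_functions g s A) = s ^ (card A - 1)"
proof -
  let ?F = "A \<rightarrow>\<^sub>E {..<s}" and ?B = "ballot_functions g s A"
  have "0 < s"
    using assms(3) by (cases s) auto
  have unique: "card {j \<in> {..<s}. rotate_values s A j f \<in> ?B} = 1" if "f \<in> ?F" for f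
  proof -
    have "\<exists>!j. j \<in> {..<s} \<and> rotate_values s A j f \<in> ?B"
      using ex1_first_minimum[OF \<open>0 < s\<close>, of "walk g A f"]
      by (simp only: lessThan_iff rotate_values_ballot_iff[OF assms(1,3) that] cong: conj_cong)
    then have "\<exists>j. {j \<in> {..<s}. rotate_values s A j f \<in> ?B} = {j}"
      by (simp only: Ex1_def set_eq_iff mem_Collect_eq singleton_iff) blast
    then show ?thesis
      by (simp add: card_1_singleton_iff)
  qed
  have each: "card {f \<in> ?F. rotate_values s A j f \<in> ?B} = card ?B" if "j \<in> {..<s}" for j
  proof -
    have bij: "bij_betw (rotate_values s A j) ?F ?F"
      using bij_betw_rotate_values \<open>finite A\<close> that by auto
    have "?B \<subseteq> ?F"
      by (auto simp: ballot_functions_def)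
    then have "?B \<subseteq> rotate_values s A j ` ?F"
      using bij by (simp add: bij_betw_def)
    then have "rotate_values s A j ` {f \<in> ?F. rotate_values s A j f \<in> ?B} = ?B"
      by blast
    then have "bij_betw (rotate_values s A j) {f \<in> ?F. rotate_values s A j f \<in> ?B} ?B"
      using bij_betw_subset[OF bij, of "{f \<in> ?F. rotate_values s A j f \<in> ?B}"] by simp
    then show ?thesis
      by (rule bij_betw_same_card)
  qed
  have "s ^ (card A - 1) * s = s ^ card A"
    using assms(1,2) by (intro power_minus_mult) (simp add: card_gt_0_iff)
  also have "\<dots> = card ?F"
    using \<open>finite A\<close> by (simp add: card_PiE)
  also have "\<dots> = (\<Sum>f\<in>?F. card {j \<in> {..<s}. rotate_values s A j f \<in> ?B})"
    using unique by simp
  also have "\<dots> = card ?B * card {..<s}"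
    using \<open>finite A\<close> each by (intro sum_multicount) (auto simp: finite_PiE)
  finally show ?thesis
    using \<open>0 < s\<close> by simp
qed

section \<open>Ballot functions as restricted parking functions\<close>

theorem theorem18:
  fixes g s :: nat and S :: "nat set"
  assumes "g \<ge> 1" and "s \<ge> 1" and "g * s \<ge> 2"
    and "S = {k * g + 1 | k. k \<le> s - 1}"
  shows "card (restricted_parking_functions (g * s - 1) S) = s ^ (g * s - 2)"
proof -
  let ?m = "g * s - 1"
  let ?A = "{1..?m}"
  let ?B = "ballot_functions g s ?A" and ?R = "restricted_parking_functions ?m S"
  let ?up = "\<lambda>h. \<lambda>x\<in>?A. h x * g + 1" and ?down = "\<lambda>\<pi>. \<lambda>x\<in>?A. (\<pi> x - 1) div g"
  have kg: "k * g \<le> ?m" if "k < s" for k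
  proof -
    have "k * g < g * s"
      using that \<open>g \<ge> 1\<close> by (simp add: mult.commute)
    then show ?thesis
      by linarith
  qed
  have up: "?up h \<in> ?R" if h: "h \<in> ?B" for h
  proof -
    have hs: "h x < s" if "x \<in> ?A" for x
      using h that by (auto simp: ballot_functions_def PiE_def Pi_def)
    have hk: "k * g \<le> card {x \<in> ?A. h x < k}" if "k < s" for k
      using h that by (simp add: ballot_functions_def)
    have count: "i \<le> card {x \<in> ?A. h x * g + 1 \<le> i}" if i: "i \<in> ?A" for i
    proof -
      \<comment> \<open>This is \<open>i / g\<close> rounded up, the number of naturals
        \<open>v\<close> with \<open>v * g + 1 \<le> i\<close>.\<close>
      define k where "k = (i - 1) div g + 1"
      have iff: "h x * g + 1 \<le> i \<longleftrightarrow> h x < k" for x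
        using i \<open>g \<ge> 1\<close> less_eq_div_iff_mult_less_eq[of g "h x" "i - 1"]
        by (auto simp: k_def)
      have "i \<le> k * g"
        using \<open>g \<ge> 1\<close> dividend_less_div_times[of g "i - 1"] i by (simp add: k_def)
      show ?thesis
      proof (cases "k < s")
        case True
        then show ?thesis
          using hk[OF True] \<open>i \<le> k * g\<close> by (simp only: iff)
      next
        \<comment> \<open>In the last block every value is below \<open>k\<close>, so all cars are
          counted.\<close>
        case False
        then have "{x \<in> ?A. h x < k} = ?A"
          using hs by force
        then have "card {x \<in> ?A. h x < k} = ?m"
          by simp
        then show ?thesis
          using i by (simp only: iff) simp
      qed
    qed
    txt \<open>For \<open>g = 1\<close> the value \<open>(s - 1) * g + 1\<close> exceeds \<open>?m\<close>; the count at \<open>i = ?m\<close> excludes it.\<close>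
    have "{x \<in> ?A. h x * g + 1 \<le> ?m} = ?A"
      using count[of ?m] \<open>g * s \<ge> 2\<close> by (intro card_seteq) auto
    then have "h x * g + 1 \<le> ?m" if "x \<in> ?A" for x
      using that by blast
    then have "?up h \<in> ?A \<rightarrow>\<^sub>E ?A"
      by (simp add: PiE_iff)
    moreover have "?up h -` {1..i} \<inter> ?A = {x \<in> ?A. h x * g + 1 \<le> i}" for i
      by auto
    moreover have "?up h ` ?A \<subseteq> S"
      using hs \<open>s \<ge> 1\<close> unfolding assms(4) by fastforce
    ultimately show ?thesis
      using count unfolding restricted_parking_functions_def parking_functions_def by simp
  qed
  have down: "?down \<pi> \<in> ?B \<and> ?up (?down \<pi>) = \<pi>" if \<pi>: "\<pi> \<in> ?R" for \<pi>
  proof -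
    have ext: "\<pi> \<in> ?A \<rightarrow>\<^sub>E ?A"
      and park: "\<And>i. i \<in> ?A \<Longrightarrow> i \<le> card (\<pi> -` {1..i} \<inter> ?A)" and "\<pi> ` ?A \<subseteq> S"
      using \<pi> by (auto simp: restricted_parking_functions_def parking_functions_def)
    have val: "1 \<le> \<pi> x" "(\<pi> x - 1) div g < s" "(\<pi> x - 1) div g * g + 1 = \<pi> x" if "x \<in> ?A" for x
    proof -
      have "\<pi> x \<in> S"
        using \<open>\<pi> ` ?A \<subseteq> S\<close> that by blast
      then obtain k where "\<pi> x = k * g + 1" "k \<le> s - 1"
        unfolding assms(4) by blast
      then show "1 \<le> \<pi> x" "(\<pi> x - 1) div g < s" "(\<pi> x - 1) div g * g + 1 = \<pi> x"
        using \<open>g \<ge> 1\<close> \<open>s \<ge> 1\<close> by simp_all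
    qed
    \<comment> \<open>The parking condition is applied at \<open>i = k * g\<close>, which lies in
      \<open>?A\<close> by \<open>kg\<close> once \<open>k > 0\<close>; the case
      \<open>k = 0\<close> is trivial.\<close>
    have "k * g \<le> card {x \<in> ?A. ?down \<pi> x < k}" if "k < s" for k
    proof (cases "k = 0")
      case False
      have "(\<pi> x - 1) div g < k \<longleftrightarrow> \<pi> x \<le> k * g" if "x \<in> ?A" for x
        using val(1)[OF that] \<open>g \<ge> 1\<close> div_less_iff_less_mult[of g "\<pi> x - 1" k] by linarith
      then have "\<pi> -` {1..k * g} \<inter> ?A = {x \<in> ?A. ?down \<pi> x < k}"
        using val(1) by auto
      then show ?thesis
        using park[of "k * g"] kg[OF that] False \<open>g \<ge> 1\<close> by simp
    qed simp
    moreover have "?down \<pi> \<in> ?A \<rightarrow>\<^sub>E {..<s}"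
      using val(2) by (simp add: PiE_iff)
    moreover have "?up (?down \<pi>) = \<pi>"
      using val(3) ext by (auto simp: fun_eq_iff PiE_def extensional_def restrict_def simp del: One_nat_def)
    ultimately show ?thesis
      unfolding ballot_functions_def by blast
  qed
  have "?down (?up h) = h" if "h \<in> ?B" for h
    using that \<open>g \<ge> 1\<close>
    by (auto simp: ballot_functions_def PiE_def extensional_def restrict_def fun_eq_iff)
  then have "bij_betw ?up ?B ?R"
    using up down by (intro bij_betw_byWitness[where f' = ?down]) blast+
  then have "card ?R = card ?B"
    by (simp add: bij_betw_same_card)
  also have "\<dots> = s ^ (card ?A - 1)"
    using \<open>g * s \<ge> 2\<close> by (intro card_ballot_functions) auto
  finally show ?thesis
    by (simp add: numeral_2_eq_2)
qed

end
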